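(* Let $f:\mathbb{Z}^n\to\mathbb{R}\cup\{+\infty\}$ be a DDM-convex function and $\alpha$ a positive integer. Then the scaled function $f^\alpha:\mathbb{Z}^n\to\mathbb{R}\cup\{+\infty\}$ defined by $f^\alpha(x)=f(\alpha x)$ $(x\in\mathbb{Z}^n)$ is also DDM-convex.
   Context: For $x,y\in\mathbb{Z}^n$, the vector $\mu(x,y)\in\mathbb{Z}^n$ is defined componentwise by $\mu(x,y)_i=\lceil (x_i+y_i)/2\rceil$ if $x_i\ge y_i$, and $\mu(x,y)_i=\lfloor (x_i+y_i)/2\rfloor$ if $x_i<y_i$. A function $f:\mathbb{Z}^n\to\mathbb{R}\cup\{+\infty\}$ is called DDM-convex if $f(x)+f(y)\ge f(\mu(x,y))+f(\mu(y,x))$ for all $x,y\in\mathbb{Z}^n$. *)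

theory Defs
  imports "HOL-Analysis.Analysis"
begin

definition dm_mu :: "int ^ 'n \<Rightarrow> int ^ 'n \<Rightarrow> int ^ 'n" where
  "dm_mu x y =
    (\<chi> i. if x $ i \<ge> y $ i then \<lceil>real_of_int (x $ i + y $ i) / 2\<rceil>
          else \<lfloor>real_of_int (x $ i + y $ i) / 2\<rfloor>)"

(* Functions into the reals extended by plus infinity only are represented as
   ereal-valued functions; the first conjunct excludes the value minus infinity.
   The effective domain is not required to be nonempty. *)
definition DDM_convex :: "(int ^ 'n \<Rightarrow> ereal) \<Rightarrow> bool" where
  "DDM_convex f \<longleftrightarrow>
    (\<forall>x. f x \<noteq> -\<infinity>) \<and>
    (\<forall>x y. f x + f y \<ge> f (dm_mu x y) + f (dm_mu y x))"

definition scaled :: "int \<Rightarrow> (int ^ 'n \<Rightarrow> ereal) \<Rightarrow> int ^ 'n \<Rightarrow> ereal" where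
  "scaled \<alpha> f x = f (\<alpha> *s x)"

end

theory Submission
  imports Defs
begin

text \<open>
  Put \<open>X = \<alpha> x\<close> and \<open>Y = \<alpha> y\<close>. One walks from \<open>X\<close> to \<open>Y\<close> by unit steps, all coordinates moving
  simultaneously: step \<open>k\<close> moves every coordinate whose distance exceeds \<open>k\<close> by one towards its
  target. Any finite set \<open>S\<close> of step numbers may be executed on its own, which leads to a point
  \<open>advance X Y S\<close>, and \<open>g S = f (advance X Y S)\<close> is a function on finite sets. Both
  \<open>\<alpha> \<mu>(x,y)\<close> and \<open>\<alpha> \<mu>(y,x)\<close>, with \<open>\<mu>\<close> the directed midpoint \<open>dm_mu\<close>, are of this form, for two complementary sets of steps: cut the
  steps into blocks of length \<open>\<alpha>\<close> and take the blocks of odd, respectively even, index. Hence the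
  theorem is an instance of the parallelogram inequality
  \<open>g {} + g U \<ge> g J + g (U - J)\<close>.

  The directed midpoints of \<open>advance X Y S\<close> and \<open>advance X Y (S \<union> U)\<close> arise from \<open>S\<close> by executing
  every second element of \<open>U\<close>, respectively the remaining elements: rounding towards the first
  argument is the same, in each coordinate, as starting the alternation with an omitted step. So
  DDM-convexity yields \<open>g S + g (S \<union> U) \<ge> g (S \<union> A) + g (S \<union> (U - A))\<close> for one
  particular \<open>A \<subseteq> U\<close>. For a two-element \<open>U\<close> this is the local form of supermodularity of \<open>g\<close>,
  and a supermodular function satisfies the parallelogram inequality. The telescoping which leads
  from local to global supermodularity needs finite values. These follow from the same inequality
  for larger \<open>U\<close>: finiteness at both ends of a Boolean interval spreads to the whole interval
  (\<open>midpoint_finite_interval\<close>).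
\<close>

section \<open>Every second element of a set of natural numbers\<close>

definition alternate :: "nat set \<Rightarrow> nat set" where
  "alternate U = {k \<in> U. odd (card (U \<inter> {..<k}))}"

lemma alternate_subset: "alternate U \<subseteq> U"
  by (auto simp: alternate_def)

lemma card_Int_lessThan_Suc:
  "card (A \<inter> {..<Suc c}) = card (A \<inter> {..<c}) + (if c \<in> A then 1 else 0)"
  by (auto simp: lessThan_Suc)

text \<open>
  Alternation halves every initial segment at once. This is what lets a single set of steps
  describe the midpoint in all coordinates, although these have different distances to cover.
\<close>

lemma card_alternate_lessThan:
  "card (alternate U \<inter> {..<c}) = card (U \<inter> {..<c}) div 2"
proof (induction c)
  case (Suc c)
  have "c \<in> alternate U \<longleftrightarrow> c \<in> U \<and> odd (card (U \<inter> {..<c}))"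
    by (simp add: alternate_def)
  with Suc show ?case
    unfolding card_Int_lessThan_Suc by auto
qed simp

lemma card_alternate:
  assumes "finite U"
  shows "card (alternate U) = card U div 2"
proof -
  obtain c where "U \<subseteq> {..<c}"
    using assms finite_nat_iff_bounded by blast
  then have "U \<inter> {..<c} = U" "alternate U \<inter> {..<c} = alternate U"
    using alternate_subset by blast+
  with card_alternate_lessThan[of U c] show ?thesis by simp
qed

lemma alternate_pair:
  assumes "k < l"
  shows "alternate {k, l} = {l}"
proof -
  have "{k, l} \<inter> {..<k} = {}" "{k, l} \<inter> {..<l} = {k}"
    using assms by auto
  then show ?thesis
    using assms by (auto simp: alternate_def)
qed

section \<open>The parallelogram inequality for midpoint convex set functions\<close>

definition midpoint_convex :: "(nat set \<Rightarrow> ereal) \<Rightarrow> bool" where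
  "midpoint_convex g \<longleftrightarrow>
    (\<forall>S. g S \<noteq> -\<infinity>) \<and>
    (\<forall>S U. finite S \<longrightarrow> finite U \<longrightarrow> S \<inter> U = {} \<longrightarrow>
      g (S \<union> alternate U) + g (S \<union> (U - alternate U)) \<le> g S + g (S \<union> U))"

lemma midpoint_convexD:
  assumes "midpoint_convex g" "finite S" "finite U" "S \<inter> U = {}"
  shows "g (S \<union> alternate U) + g (S \<union> (U - alternate U)) \<le> g S + g (S \<union> U)"
  using assms by (simp add: midpoint_convex_def)

lemma midpoint_convex_not_MInf: "midpoint_convex g \<Longrightarrow> g S \<noteq> -\<infinity>"
  by (simp add: midpoint_convex_def)

text \<open>
  If \<open>U\<close> has at least two elements, both halves of \<open>U\<close> are proper subsets. By induction on the
  size of \<open>U\<close>, the intervals from \<open>S\<close> to \<open>S\<close> plus either half consist of points of finiteness;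
  these intervals contain \<open>S \<union> {k}\<close> for every \<open>k \<in> U\<close>. Each nonempty \<open>J \<subseteq> U\<close> contains such a \<open>k\<close>,
  and \<open>S \<union> J\<close> lies in the shorter interval from \<open>S \<union> {k}\<close> to \<open>S \<union> U\<close>.
\<close>

lemma midpoint_finite_interval:
  assumes g: "midpoint_convex g"
    and "finite S" "finite U" "S \<inter> U = {}" "g S \<noteq> \<infinity>" "g (S \<union> U) \<noteq> \<infinity>" "J \<subseteq> U"
  shows "g (S \<union> J) \<noteq> \<infinity>"
  using assms(2-)
proof (induction "card U" arbitrary: S U J rule: less_induct)
  case less
  show ?case
  proof (cases "J = {} \<or> J = U")
    case True
    with less.prems show ?thesis by auto
  next
    case False
    then obtain k where k: "k \<in> J" by blast
    have "J \<subset> U" "finite J" using False less.prems finite_subset by auto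
    then have "card J < card U" "card J \<noteq> 0"
      using less.prems k by (auto simp: psubset_card_mono)
    then have two: "card U \<ge> 2" by linarith
    let ?A = "alternate U"
    have sub: "?A \<subseteq> U" by (rule alternate_subset)
    have fin: "finite ?A" using sub less.prems finite_subset by blast
    have cA: "card ?A < card U" "card (U - ?A) < card U"
      using card_alternate[of U] less.prems two sub fin by (auto simp: card_Diff_subset)
    have "g (S \<union> ?A) + g (S \<union> (U - ?A)) \<le> g S + g (S \<union> U)"
      using g less.prems by (intro midpoint_convexD)
    moreover have "g (S \<union> ?A) \<noteq> -\<infinity>" "g (S \<union> (U - ?A)) \<noteq> -\<infinity>"
      using g by (simp_all add: midpoint_convex_not_MInf)
    ultimately have half: "g (S \<union> ?A) \<noteq> \<infinity>" "g (S \<union> (U - ?A)) \<noteq> \<infinity>"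
      using less.prems by auto
    have kU: "k \<in> U" using k less.prems by blast
    have single: "g (S \<union> {k}) \<noteq> \<infinity>"
    proof (cases "k \<in> ?A")
      case True
      have "S \<inter> ?A = {}" using sub less.prems by blast
      with less.hyps[OF cA(1), of S "{k}"] True half fin less.prems show ?thesis by blast
    next
      case False
      have "S \<inter> (U - ?A) = {}" using less.prems by blast
      with less.hyps[OF cA(2), of S "{k}"] False kU half less.prems show ?thesis by blast
    qed
    have "card (U - {k}) < card U"
      using kU less.prems by (meson card_Diff1_less)
    moreover have "(S \<union> {k}) \<union> (U - {k}) = S \<union> U" "(S \<union> {k}) \<union> (J - {k}) = S \<union> J"
      using k kU by auto
    ultimately show ?thesis
      using less.hyps[of "U - {k}" "S \<union> {k}" "J - {k}"] single less.prems by auto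
  qed
qed

text \<open>
  For finite values, local supermodularity says that the marginal value of an element grows when
  another element is added. Adding the elements of \<open>A\<close> one after the other, and then telescoping
  over \<open>B\<close>, gives the same for sets.
\<close>

lemma supermodular_real:
  fixes h :: "nat set \<Rightarrow> real"
  assumes local: "\<And>R k l. R \<subseteq> V \<Longrightarrow> k \<in> V \<Longrightarrow> l \<in> V \<Longrightarrow> k \<notin> R \<Longrightarrow> l \<notin> R \<Longrightarrow> k \<noteq> l \<Longrightarrow>
      h (insert k R) + h (insert l R) \<le> h R + h (insert k (insert l R))"
    and "finite A" "finite B" "A \<subseteq> V" "B \<subseteq> V" "A \<inter> B = {}"
  shows "h A + h B \<le> h {} + h (A \<union> B)"
proof -
  have marginal: "h (R \<union> A) + h (insert l R) \<le> h R + h (insert l (R \<union> A))"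
    if "finite A" "A \<subseteq> V" "R \<subseteq> V" "l \<in> V" "l \<notin> R" "l \<notin> A" "R \<inter> A = {}" for R A l
    using that
  proof (induction A rule: finite_induct)
    case (insert k A)
    then have "h (insert k (R \<union> A)) + h (insert l (R \<union> A))
        \<le> h (R \<union> A) + h (insert k (insert l (R \<union> A)))"
      by (intro local) auto
    moreover have "h (R \<union> A) + h (insert l R) \<le> h R + h (insert l (R \<union> A))"
      using insert by auto
    ultimately show ?case by (simp add: insert_commute)
  qed simp
  show ?thesis
    using assms(3,5,6)
  proof (induction B rule: finite_induct)
    case (insert l B)
    then have "h (B \<union> A) + h (insert l B) \<le> h B + h (insert l (B \<union> A))"
      using assms by (intro marginal) auto
    moreover have "h A + h B \<le> h {} + h (A \<union> B)"
      using insert by auto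
    ultimately show ?case by (simp add: Un_commute)
  qed simp
qed

theorem parallelogram_inequality:
  assumes g: "midpoint_convex g" and "finite U" and "J \<subseteq> U"
  shows "g J + g (U - J) \<le> g {} + g U"
proof (cases "g {} = \<infinity> \<or> g U = \<infinity>")
  case True
  with midpoint_convex_not_MInf[OF g] show ?thesis by auto
next
  case False
  define h where "h S = real_of_ereal (g S)" for S
  have gh: "g S = ereal (h S)" if "S \<subseteq> U" for S
    using midpoint_finite_interval[OF g, of "{}" U S] midpoint_convex_not_MInf[OF g, of S]
      False that \<open>finite U\<close>
    by (auto simp: h_def ereal_real)
  \<comment> \<open>The midpoint inequality for a two-element set is local supermodularity.\<close>
  have ordered: "h (insert k R) + h (insert l R) \<le> h R + h (insert k (insert l R))"
    if R: "R \<subseteq> U" "k \<in> U" "l \<in> U" "k \<notin> R" "l \<notin> R" "k < l" for R k l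
  proof -
    have "finite R" using R \<open>finite U\<close> finite_subset by blast
    then have "g (R \<union> alternate {k, l}) + g (R \<union> ({k, l} - alternate {k, l}))
        \<le> g R + g (R \<union> {k, l})"
      using R by (intro midpoint_convexD[OF g]) auto
    moreover have "R \<union> alternate {k, l} = insert l R"
      "R \<union> ({k, l} - alternate {k, l}) = insert k R" "R \<union> {k, l} = insert k (insert l R)"
      using R by (auto simp: alternate_pair)
    ultimately show ?thesis
      using R by (simp add: gh add.commute)
  qed
  have "h J + h (U - J) \<le> h {} + h (J \<union> (U - J))"
  proof (rule supermodular_real[where V = U])
    fix R k l
    assume "R \<subseteq> U" "k \<in> U" "l \<in> U" "k \<notin> R" "l \<notin> R" "k \<noteq> l"
    then show "h (insert k R) + h (insert l R) \<le> h R + h (insert k (insert l R))"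
      using ordered[of R k l] ordered[of R l k]
      by (cases "k < l") (auto simp: insert_commute add.commute)
  qed (use assms finite_subset in auto)
  moreover have "J \<union> (U - J) = U" using \<open>J \<subseteq> U\<close> by blast
  ultimately show ?thesis
    using \<open>J \<subseteq> U\<close> by (simp add: gh)
qed

section \<open>Directed midpoints as partial walks\<close>

lemma dm_mu_nth:
  "dm_mu x y $ i = x $ i + sgn (y $ i - x $ i) * (\<bar>y $ i - x $ i\<bar> div 2)"
proof -
  have "\<lfloor>real_of_int (x $ i + y $ i) / 2\<rfloor> = (x $ i + y $ i) div 2"
    using floor_divide_of_int_eq[of "x $ i + y $ i" 2] by simp
  moreover have "\<lceil>real_of_int (x $ i + y $ i) / 2\<rceil> = - ((- (x $ i + y $ i)) div 2)"
    using ceiling_divide_eq_div[of "x $ i + y $ i" 2] by simp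
  ultimately show ?thesis
    by (auto simp: dm_mu_def sgn_if)
qed

lemma dm_mu_add: "dm_mu x y + dm_mu y x = x + y"
proof -
  have "sgn (x $ i - y $ i) = - sgn (y $ i - x $ i)" for i
    by (simp add: sgn_if)
  then show ?thesis
    by (simp add: vec_eq_iff dm_mu_nth abs_minus_commute[of "x $ _"])
qed

definition advance :: "int ^ 'n \<Rightarrow> int ^ 'n \<Rightarrow> nat set \<Rightarrow> int ^ 'n" where
  "advance x y S =
    (\<chi> i. x $ i + sgn (y $ i - x $ i) * int (card (S \<inter> {..<nat \<bar>y $ i - x $ i\<bar>})))"

lemma advance_empty: "advance x y {} = x"
  by (simp add: advance_def vec_eq_iff)

lemma advance_all:
  assumes "\<And>i. nat \<bar>y $ i - x $ i\<bar> \<le> m"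
  shows "advance x y {..<m} = y"
proof -
  have "{..<m} \<inter> {..<nat \<bar>y $ i - x $ i\<bar>} = {..<nat \<bar>y $ i - x $ i\<bar>}" for i
    using assms[of i] by auto
  then show ?thesis
    by (simp add: advance_def vec_eq_iff sgn_mult_abs)
qed

lemma card_Un_Int_lessThan:
  assumes "A \<inter> B = {}"
  shows "card ((A \<union> B) \<inter> {..<c::nat}) = card (A \<inter> {..<c}) + card (B \<inter> {..<c})"
  using assms by (subst card_Un_disjoint[symmetric]) (auto simp: Int_Un_distrib2)

text \<open>
  Complementary sets of steps yield points with a fixed sum, just as the two directed midpoints
  do (\<open>dm_mu_add\<close>). So it suffices to identify one member of such a pair.
\<close>

lemma advance_modular:
  assumes "S \<inter> A = {}" "S \<inter> B = {}" "A \<inter> B = {}"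
  shows "advance x y (S \<union> A) + advance x y (S \<union> B) = advance x y S + advance x y (S \<union> (A \<union> B))"
proof -
  have "S \<inter> (A \<union> B) = {}" using assms by blast
  with assms show ?thesis
    by (simp add: vec_eq_iff advance_def card_Un_Int_lessThan algebra_simps)
qed

text \<open>
  A coordinate in which \<open>c\<close> of the steps in \<open>U\<close> are effective differs by \<open>c\<close> between the two
  points. Rounding towards the first point means advancing it by \<open>c div 2\<close>, which is the
  number of effective steps in \<open>alternate U\<close>.
\<close>

lemma dm_mu_advance:
  assumes "S \<inter> U = {}"
  shows "dm_mu (advance x y S) (advance x y (S \<union> U)) = advance x y (S \<union> alternate U)"
    and "dm_mu (advance x y (S \<union> U)) (advance x y S) = advance x y (S \<union> (U - alternate U))"
proof -
  have disj: "S \<inter> alternate U = {}" "S \<inter> (U - alternate U) = {}"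
      "alternate U \<inter> (U - alternate U) = {}" "alternate U \<union> (U - alternate U) = U"
    using assms alternate_subset[of U] by blast+
  have half: "sgn (sgn z * int c) * (\<bar>sgn z * int c\<bar> div 2) = sgn z * int (c div 2)" for z :: int and c
    by (auto simp: sgn_if zdiv_int)
  show first: "dm_mu (advance x y S) (advance x y (S \<union> U)) = advance x y (S \<union> alternate U)"
    by (simp add: vec_eq_iff dm_mu_nth advance_def card_Un_Int_lessThan assms disj
        card_alternate_lessThan distrib_left half)
  show "dm_mu (advance x y (S \<union> U)) (advance x y S) = advance x y (S \<union> (U - alternate U))"
    using dm_mu_add[of "advance x y S" "advance x y (S \<union> U)"] first
      advance_modular[of S "alternate U" "U - alternate U" x y] disj
    by (metis add_left_cancel)
qed

lemma midpoint_convex_advance: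
  assumes "DDM_convex f"
  shows "midpoint_convex (\<lambda>S. f (advance x y S))"
  unfolding midpoint_convex_def
proof (intro conjI allI impI)
  fix S U :: "nat set"
  assume "S \<inter> U = {}"
  then show "f (advance x y (S \<union> alternate U)) + f (advance x y (S \<union> (U - alternate U)))
      \<le> f (advance x y S) + f (advance x y (S \<union> U))"
    using assms by (simp add: DDM_convex_def flip: dm_mu_advance)
qed (use assms in \<open>simp add: DDM_convex_def\<close>)

section \<open>Scaling\<close>

lemma card_odd_blocks:
  assumes "a > 0"
  shows "card ({k. odd (k div a)} \<inter> {..<a * d}) = a * (d div 2)"
proof (induction d)
  case (Suc d)
  let ?J = "{k. odd (k div a)}"
  have block: "k div a = d" if "k \<in> {a * d..<a * Suc d}" for k
    using that assms by (intro div_nat_eqI) (auto simp: mult.commute)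
  have "{..<a * Suc d} = {..<a * d} \<union> {a * d..<a * Suc d}" by auto
  then have "?J \<inter> {..<a * Suc d} = (?J \<inter> {..<a * d}) \<union> (?J \<inter> {a * d..<a * Suc d})"
    by blast
  moreover have "?J \<inter> {a * d..<a * Suc d} = (if odd d then {a * d..<a * Suc d} else {})"
    using block by auto
  moreover have "(?J \<inter> {..<a * d}) \<inter> (?J \<inter> {a * d..<a * Suc d}) = {}"
    by auto
  ultimately have "card (?J \<inter> {..<a * Suc d})
      = card (?J \<inter> {..<a * d}) + (if odd d then a else 0)"
    by (simp add: card_Un_disjoint)
  moreover have "Suc d div 2 = d div 2 + (if odd d then 1 else 0)"
    by auto
  ultimately show ?case
    unfolding Suc by (simp add: distrib_left)
qed simp

theorem theorem6p1:
  fixes f :: "int ^ 'n \<Rightarrow> ereal" and \<alpha> :: int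
  assumes "DDM_convex f" and "\<alpha> > 0"
  shows "DDM_convex (scaled \<alpha> f)"
  unfolding DDM_convex_def
proof (intro conjI allI)
  show "scaled \<alpha> f x \<noteq> -\<infinity>" for x
    using assms by (simp add: DDM_convex_def scaled_def)
next
  fix x y :: "int ^ 'n"
  define a where "a = nat \<alpha>"
  have a: "a > 0" "\<alpha> = int a" using assms by (auto simp: a_def)
  define d where "d i = nat \<bar>y $ i - x $ i\<bar>" for i
  let ?X = "\<alpha> *s x" and ?Y = "\<alpha> *s y"
  have dist: "nat \<bar>?Y $ i - ?X $ i\<bar> = a * d i" for i
    by (simp add: a d_def abs_mult nat_mult_distrib flip: right_diff_distrib)
  have sgn: "sgn (?Y $ i - ?X $ i) = sgn (y $ i - x $ i)" for i
    using a by (simp add: sgn_mult flip: right_diff_distrib)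
  define m where "m = Max (range (\<lambda>i. a * d i))"
  have m: "a * d i \<le> m" for i unfolding m_def by (rule Max_ge) auto
  \<comment> \<open>Coordinate \<open>i\<close> has \<open>d i\<close> blocks of \<open>a\<close> steps to go. Blocks are indexed from 0, so
    \<open>d i div 2\<close> of them have odd index: half of the blocks, rounded down.\<close>
  define J where "J = {k. odd (k div a)} \<inter> {..<m}"
  have cardJ: "card (J \<inter> {..<a * d i}) = a * (d i div 2)" for i
  proof -
    have "J \<inter> {..<a * d i} = {k. odd (k div a)} \<inter> {..<a * d i}"
      using m[of i] by (auto simp: J_def)
    then show ?thesis using card_odd_blocks[OF a(1)] by simp
  qed
  have all: "advance ?X ?Y {..<m} = ?Y"
    by (rule advance_all) (simp only: dist m)
  have J1: "advance ?X ?Y J = \<alpha> *s dm_mu x y"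
    unfolding vec_eq_iff advance_def vec_lambda_beta dist sgn cardJ
    by (simp add: dm_mu_nth a d_def zdiv_int algebra_simps)
  have J2: "advance ?X ?Y ({..<m} - J) = \<alpha> *s dm_mu y x"
  proof -
    have "J \<union> ({..<m} - J) = {..<m}" by (auto simp: J_def)
    then have "advance ?X ?Y J + advance ?X ?Y ({..<m} - J) = ?X + ?Y"
      using advance_modular[of "{}" J "{..<m} - J" ?X ?Y] by (simp add: advance_empty all)
    also have "\<dots> = \<alpha> *s dm_mu x y + \<alpha> *s dm_mu y x"
      by (simp add: dm_mu_add flip: vector_add_ldistrib)
    finally show ?thesis by (simp add: J1)
  qed
  have "f (advance ?X ?Y J) + f (advance ?X ?Y ({..<m} - J))
      \<le> f (advance ?X ?Y {}) + f (advance ?X ?Y {..<m})"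
    by (rule parallelogram_inequality[OF midpoint_convex_advance[OF assms(1)]])
       (auto simp: J_def)
  then show "scaled \<alpha> f (dm_mu x y) + scaled \<alpha> f (dm_mu y x) \<le> scaled \<alpha> f x + scaled \<alpha> f y"
    by (simp add: scaled_def J1 J2 advance_empty all)
qed

end
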